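(* Let $A$ be a finite alphabet, let $K \geq 1$ be an integer, and let $x \in A^\omega$ be a right-infinite word that is linearly recurrent with constant $K$ and aperiodic. Then $x \in \mathcal{P}_{\mathrm{m}}$. More specifically, $x \in \mathcal{P}_{\mathrm{m}}(K+1, k)$ for $$k = 2 + \sum_{i=0}^{K^5-1} 2 K^i (K+1)^{2i}.$$
   Context: $A^\omega$ is the set of right-infinite words $x = x_0 x_1 x_2 \cdots$ over $A$; $A^+$ is the set of nonempty finite words over $A$; $x_{[n,\infty)} = x_n x_{n+1} \cdots$. $\mathrm{Fact}^+ x \subset A^+$ is the set of nonempty finite factors (contiguous subwords) of $x$. $|u|$ denotes the length of a finite word $u$. Periodicity: $x$ is periodic if $x = x_{[n,\infty)}$ for some $n \geq 1$, and aperiodic otherwise. Linear recurrence: for $u \in \mathrm{Fact}^+ x$, a return to $u$ in $x$ is a word $w \in A^+$ such that $wu \in \mathrm{Fact}^+ x$ and $u$ occurs exactly twice in $wu$. The set of returns to $u$ in $x$ is denoted $\mathcal{R}_x(u)$. The word $x$ is linearly recurrent with constant $K$ if for all $u \in \mathrm{Fact}^+ x$ and all $w \in \mathcal{R}_x(u)$ we have $|w| \leq K|u|$. Colorings and factorizations: a factor coloring of $x$ is a function $c : \mathrm{Fact}^+ x \to C$ with $C$ a finite set. A factorization of a finite or right-infinite word $y$ is a sequence $(U_i)_i$ of nonempty finite factors of $y$ (a finite sequence if $y$ is finite) whose concatenation in order is $y$; its length is the number of words in the sequence. It is monotone if $|U_i| \leq |U_j|$ for all $i \leq j$, and $c$-monochromatic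 if $c(U_i) = c(U_j)$ for all $i, j$. Classes: for $h, k \geq 1$, $\mathcal{P}_{\mathrm{m}}(h,k)$ is the class of infinite words $x \in A^\omega$ for which there exists a factor coloring $c : \mathrm{Fact}^+ x \to C$ with $|C| \leq k$ such that no prefix of $x$ has a monotone $c$-monochromatic factorization of length $h$. For $h = \infty$, $\mathcal{P}_{\mathrm{m}}(\infty,k)$ is the class of infinite words $x$ for which there is a factor coloring $c$ with $|C| \leq k$ such that $x$ itself has no monotone $c$-monochromatic factorization (into infinitely many words). Finally $\mathcal{P}_{\mathrm{m}} = \bigcup_{k \geq 1} \mathcal{P}_{\mathrm{m}}(\infty,k)$.
   Formalization: The second claim, x in P_m(K+1,k), is stated only for recurrent x (every factor occurs infinitely often); linear recurrence as defined does not imply this, and without it the claim fails, e.g. for x = a^{K+1} b a a a ... with K ≥ 2. The first claim is unchanged. *)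

theory Defs
  imports Complex_Main "HOL-Library.Stream" "HOL-Library.Sublist"
    "HOL-Library.Extended_Nat" "HOL-Library.FuncSet"
begin

definition Fact :: "'a stream \<Rightarrow> 'a list set" where
  "Fact x = {stake n (sdrop i x) | i n. n \<ge> 1}"

definition list_Fact :: "'a list \<Rightarrow> 'a list set" where
  "list_Fact y = {u. u \<noteq> [] \<and> sublist u y}"

definition periodic :: "'a stream \<Rightarrow> bool" where
  "periodic x \<longleftrightarrow> (\<exists>n\<ge>1. x = sdrop n x)"

abbreviation aperiodic :: "'a stream \<Rightarrow> bool" where
  "aperiodic x \<equiv> \<not> periodic x"

text \<open>Occurrences are starting positions; overlapping occurrences are counted separately.\<close>

definition occs :: "'a list \<Rightarrow> 'a list \<Rightarrow> nat set" where
  "occs u v = {i. i + length u \<le> length v \<and> take (length u) (drop i v) = u}"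

lemma occs_iff:
  "i \<in> occs u v \<longleftrightarrow> i + length u \<le> length v \<and> (\<forall>j<length u. v ! (i + j) = u ! j)"
  unfolding occs_def by (auto simp: list_eq_iff_nth_eq)

definition returns :: "'a stream \<Rightarrow> 'a list \<Rightarrow> 'a list set" where
  "returns x u = {w. w \<noteq> [] \<and> w @ u \<in> Fact x \<and> card (occs u (w @ u)) = 2}"

definition linearly_recurrent :: "nat \<Rightarrow> 'a stream \<Rightarrow> bool" where
  "linearly_recurrent K x \<longleftrightarrow>
     (\<forall>u\<in>Fact x. \<forall>w\<in>returns x u. length w \<le> K * length u)"

text \<open>
  The predicate \<open>linearly_recurrent\<close> says nothing about a factor that occurs only once, since
  such a factor has no returns. Recurrence, often taken to be part of the notion of linear
  recurrence, is therefore a separate property; see \<open>recurrence_needed\<close> below.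
\<close>

definition recurrent :: "'a stream \<Rightarrow> bool" where
  "recurrent x \<longleftrightarrow> (\<forall>u\<in>Fact x. infinite {i. stake (length u) (sdrop i x) = u})"

definition list_factorization :: "'a list list \<Rightarrow> 'a list \<Rightarrow> bool" where
  "list_factorization U y \<longleftrightarrow> set U \<subseteq> list_Fact y \<and> concat U = y"

definition list_monotone :: "'a list list \<Rightarrow> bool" where
  "list_monotone U \<longleftrightarrow> (\<forall>j<length U. \<forall>i\<le>j. length (U ! i) \<le> length (U ! j))"

definition list_monochromatic :: "('a list \<Rightarrow> 'c) \<Rightarrow> 'a list list \<Rightarrow> bool" where
  "list_monochromatic c U \<longleftrightarrow> (\<forall>i<length U. \<forall>j<length U. c (U ! i) = c (U ! j))"

definition factorization :: "'a list stream \<Rightarrow> 'a stream \<Rightarrow> bool" where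
  "factorization U y \<longleftrightarrow> sset U \<subseteq> Fact y \<and> flat U = y"

definition monotone_stream :: "'a list stream \<Rightarrow> bool" where
  "monotone_stream U \<longleftrightarrow> (\<forall>i j. i \<le> j \<longrightarrow> length (U !! i) \<le> length (U !! j))"

definition monochromatic_stream :: "('a list \<Rightarrow> 'c) \<Rightarrow> 'a list stream \<Rightarrow> bool" where
  "monochromatic_stream c U \<longleftrightarrow> (\<forall>i j. c (U !! i) = c (U !! j))"

text \<open>
  \<open>avoids c h x\<close>: for finite \<open>h\<close>, no prefix of \<open>x\<close> has a monotone \<open>c\<close>-monochromatic
  factorization of length \<open>h\<close>; for \<open>h = \<infinity>\<close>, \<open>x\<close> itself has none.
\<close>

definition avoids :: "('a list \<Rightarrow> 'c) \<Rightarrow> enat \<Rightarrow> 'a stream \<Rightarrow> bool" where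
  "avoids c h x \<longleftrightarrow>
     (case h of
        enat n \<Rightarrow> \<not> (\<exists>m U. list_factorization U (stake m x) \<and> length U = n \<and>
                       list_monotone U \<and> list_monochromatic c U)
      | \<infinity> \<Rightarrow> \<not> (\<exists>U. factorization U x \<and> monotone_stream U \<and> monochromatic_stream c U))"

text \<open>
  Colour sets are finite sets of natural numbers, which loses nothing as only their cardinality
  matters. Values of a colouring outside \<open>Fact x\<close> are never inspected.
\<close>

definition Pm :: "'a set \<Rightarrow> enat \<Rightarrow> nat \<Rightarrow> 'a stream set" where
  "Pm A h k = {x \<in> streams A. \<exists>(C :: nat set) c.
     finite C \<and> card C \<le> k \<and> c \<in> Fact x \<rightarrow> C \<and> avoids c h x}"

definition Pm_class :: "'a set \<Rightarrow> 'a stream set" where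
  "Pm_class A = (\<Union>k\<in>{1..}. Pm A \<infinity> k)"

text \<open>
  Without recurrence, linear recurrence with constant \<open>K\<close> and aperiodicity do not imply membership
  in \<open>Pm A (K + 1) k\<close>, for any number \<open>k\<close> of colours.
\<close>

lemma recurrence_needed:
  fixes a b :: 'a and K :: nat
  assumes ab: "a \<noteq> b" and K: "K \<ge> 2"
  defines "x \<equiv> replicate (K + 1) a @- b ## sconst a"
  shows "linearly_recurrent K x" and "aperiodic x" and "x \<notin> Pm A (enat (K + 1)) k"
proof -
  have nth: "x !! i = (if i = K + 1 then b else a)" for i
  proof -
    have "(b ## sconst a) !! j = (if j = 0 then b else a)" for j
      by (cases j) auto
    then show ?thesis
      unfolding x_def
      by (cases "i < K + 1") (simp_all add: shift_snth_less shift_snth_ge del: replicate.simps)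
  qed
  show "aperiodic x"
  proof
    assume "periodic x"
    then obtain n where n: "n \<ge> 1" "x = sdrop n x" unfolding periodic_def by blast
    have "x !! (K + 1) = x !! (n + (K + 1))"
      using arg_cong[OF n(2), of "\<lambda>y. y !! (K + 1)"] by (simp only: sdrop_snth)
    then show False using n(1) ab unfolding nth by (auto split: if_splits)
  qed
  show "x \<notin> Pm A (enat (K + 1)) k"
  proof
    assume "x \<in> Pm A (enat (K + 1)) k"
    then obtain c :: "'a list \<Rightarrow> nat" where c: "avoids c (enat (K + 1)) x"
      unfolding Pm_def by blast
    let ?U = "replicate (K + 1) [a]"
    have "stake (K + 1) x = replicate (K + 1) a"
      by (rule nth_equalityI) (auto simp: stake_nth nth simp del: replicate.simps stake.simps)
    moreover have "concat (replicate n [a]) = replicate n a" for n by (induction n) auto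
    moreover have "sublist [a] (replicate (K + 1) a)"
      by (simp add: sublist_Cons_right)
    ultimately have "list_factorization ?U (stake (K + 1) x)"
      unfolding list_factorization_def list_Fact_def
      by (auto simp del: replicate.simps stake.simps)
    moreover have "list_monotone ?U" "list_monochromatic c ?U"
      unfolding list_monotone_def list_monochromatic_def
      by (auto simp del: replicate.simps)
    moreover have "length ?U = K + 1" by simp
    ultimately show False using c unfolding avoids_def enat.case by blast
  qed
  show "linearly_recurrent K x"
    unfolding linearly_recurrent_def
  proof (intro ballI)
    fix u w assume "u \<in> Fact x" and "w \<in> returns x u"
    let ?v = "w @ u" and ?n = "length u" and ?l = "length w"
    have u: "?n \<ge> 1" using \<open>u \<in> Fact x\<close> unfolding Fact_def by auto
    have w: "?v \<in> Fact x" "card (occs u ?v) = 2" "w \<noteq> []"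
      using \<open>w \<in> returns x u\<close> unfolding returns_def by auto
    then obtain s m where sm: "?v = stake m (sdrop s x)" unfolding Fact_def by blast
    have m: "m = ?l + ?n" using arg_cong[OF sm, of length] by simp
    have v: "?v ! i = (if s + i = K + 1 then b else a)" if "i < ?l + ?n" for i
      unfolding sm using that by (simp add: m stake_nth sdrop_snth nth)
    have occI: "i \<in> occs u ?v" if "i + ?n \<le> ?l + ?n" "\<And>j. j < ?n \<Longrightarrow> ?v ! (i + j) = u ! j" for i
      unfolding occs_iff using that by simp
    have occD: "i + ?n \<le> ?l + ?n \<and> (\<forall>j<?n. ?v ! (i + j) = u ! j)" if "i \<in> occs u ?v" for i
      using that unfolding occs_iff by simp
    have fin: "finite (occs u ?v)"
      by (rule finite_subset[of _ "{..?l}"]) (auto simp: occs_def)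
    obtain p where p: "p \<in> occs u ?v" "p \<noteq> ?l"
    proof -
      have "\<not> occs u ?v \<subseteq> {?l}" using w(2) card_mono[of "{?l}" "occs u ?v"] by auto
      then show ?thesis using that by blast
    qed
    have ua: "u ! j = a" if "j < ?n" for j
    proof (rule ccontr)
      assume "u ! j \<noteq> a"
      moreover have "?v ! (?l + j) = u ! j" by simp
      moreover have "?v ! (p + j) = u ! j" using occD[OF p(1)] that by blast
      moreover have "p + j < ?l + ?n" using occD[OF p(1)] that by linarith
      ultimately show False using v[of "?l + j"] v[of "p + j"] that p(2) by (auto split: if_splits)
    qed
    have occ: "i \<in> occs u ?v" if "i \<le> ?l" "\<And>j. j < ?n \<Longrightarrow> s + (i + j) \<noteq> K + 1" for i
      using that by (intro occI) (auto simp: v ua)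
    have three: False if "i < j" "j < m" "{i, j, m} \<subseteq> occs u ?v" for i j m
      using card_mono[OF fin that(3)] that(1,2) w(2) by auto
    have L: "?l \<in> occs u ?v" by (intro occI) auto
    have tl: "s + (?l + j) \<noteq> K + 1" if "j < ?n" for j
      using v[of "?l + j"] ua[OF that] that ab by (auto split: if_splits)
    have "?l \<le> 2 * ?n"
    proof (rule ccontr)
      assume "\<not> ?l \<le> 2 * ?n"
      then have l: "?l \<ge> 2 * ?n + 1" by simp
      consider "K + 1 < s + (?l - 2) \<or> s + (?l + ?n) \<le> K + 1" | "K + 1 = s + (?l - 2)" "?n = 1"
        | "s + (?l - 2) \<le> K + 1" "K + 1 < s + ?l" "?n \<ge> 2 \<or> K + 1 = s + (?l - 1)"
        using tl[of "K + 1 - s - ?l"] l u by linarith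
      then show False
      proof cases
        case 1
        have "?l - 2 \<in> occs u ?v" "?l - 1 \<in> occs u ?v"
          using 1 l u by (auto intro!: occ)
        moreover have "?l - 2 < ?l - 1" "?l - 1 < ?l" using l u by linarith+
        ultimately show False using three[of "?l - 2" "?l - 1" ?l] L by blast
      next
        case 2
        have "0 \<in> occs u ?v" "?l - 1 \<in> occs u ?v"
          using 2 l u by (auto intro!: occ)
        moreover have "0 < ?l - 1" "?l - 1 < ?l" using l u by linarith+
        ultimately show False using three[of 0 "?l - 1" ?l] L by blast
      next
        case 3
        have "0 \<in> occs u ?v" "1 \<in> occs u ?v"
          using 3 l u by (auto intro!: occ)
        moreover have "0 < (1::nat)" "1 < ?l" using l u by linarith+
        ultimately show False using three[of 0 1 ?l] L by simp
      qed
    qed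
    also have "\<dots> \<le> K * ?n" using K by simp
    finally show "?l \<le> K * ?n" .
  qed
qed

end

(*
  Linear recurrence forces every window of K n consecutive positions to contain an occurrence of
  each factor of length n, and aperiodicity forces two occurrences of a factor of length n to be
  more than n / K apart. Put w on level j when K^j <= |w| < K^(j+1), and let p_j be the prefix
  of x of length n = K^j. The colour of w records whether p_j is a prefix of w, whether w p_j is a
  factor, and if so the level modulo 3 and the numbers floor (K q / n) and floor (K |w| / n),
  where q is the first position of w p_j. As q and q + |w| are occurrences of p_j, these numbers
  determine w among the words of its level.

  In a monotone monochromatic factorization U_0 ... U_K of a prefix, U_0 is itself a prefix, so
  every U_i starts with the prefix p of its level; a jump of levels would put a long prefix of x too
  close to its occurrence at 0. So all levels agree, all U_i are equal, and x starts with a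
  (K+1)-st power, contradicting the gap bound.

  A word that is not recurrent has a prefix p occurring only once. Colouring words shorter than p
  by themselves and longer ones by whether they start with p leaves only periodic words.
*)

theory Submission
  imports Defs "HOL-Library.Multiset"
begin

section \<open>Factors as words read off at positions\<close>

definition word_at :: "'a stream \<Rightarrow> nat \<Rightarrow> nat \<Rightarrow> 'a list" where
  "word_at x i n = stake n (sdrop i x)"

lemma length_word_at [simp]: "length (word_at x i n) = n"
  by (simp add: word_at_def)

lemma nth_word_at [simp]: "e < n \<Longrightarrow> word_at x i n ! e = x !! (i + e)"
  by (simp add: word_at_def sdrop_snth)

lemma word_at_eq_iff: "word_at x i n = word_at y j n \<longleftrightarrow> (\<forall>e<n. x !! (i + e) = y !! (j + e))"
  by (auto simp: list_eq_iff_nth_eq)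

lemma word_at_add: "word_at x i (m + n) = word_at x i m @ word_at x (i + m) n"
  by (auto simp: list_eq_iff_nth_eq nth_append)

lemma take_word_at [simp]: "m \<le> n \<Longrightarrow> take m (word_at x i n) = word_at x i m"
  by (auto simp: list_eq_iff_nth_eq)

lemma word_at_in_Fact [simp]: "n \<ge> 1 \<Longrightarrow> word_at x i n \<in> Fact x"
  by (auto simp: Fact_def word_at_def)

lemma Fact_nonempty: "u \<in> Fact x \<Longrightarrow> u \<noteq> []"
  by (auto simp: Fact_def Suc_le_eq gr0_conv_Suc)

lemma Fact_word_at: "u \<in> Fact x \<Longrightarrow> \<exists>i. u = word_at x i (length u)"
  by (auto simp: Fact_def word_at_def)

lemma stream_eqI: "(\<And>n. s !! n = t !! n) \<Longrightarrow> s = t"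
  by (metis ext stream_smap_nats)

lemma list_Fact_stake_subset: "list_Fact (stake m x) \<subseteq> Fact x"
proof
  fix u assume "u \<in> list_Fact (stake m x)"
  then obtain a b where u: "u \<noteq> []" "stake m x = a @ u @ b"
    by (auto simp: list_Fact_def sublist_def)
  have "u = word_at x (length a) (length u)"
  proof (rule nth_equalityI)
    fix e assume e: "e < length u"
    have "length a + length u + length b = m"
      using arg_cong[OF u(2), of length] by simp
    then have "stake m x ! (length a + e) = x !! (length a + e)"
      using e by (intro stake_nth) simp
    then show "u ! e = word_at x (length a) (length u) ! e"
      using e by (simp add: u(2) nth_append)
  qed simp
  then show "u \<in> Fact x"
    using u(1) by (metis One_nat_def Suc_leI length_greater_0_conv word_at_in_Fact)
qed

section \<open>Windows and gaps between occurrences\<close>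

text \<open>For neighbouring occurrences \<open>a\<close> and \<open>b\<close> of \<open>u\<close>,
  the word \<open>w\<close> from \<open>a\<close> up to \<open>b\<close> is a return:
  \<open>u\<close> occurs in \<open>w @ u\<close> only at 0 and \<open>b - a\<close>, even if the
  two overlap.\<close>

lemma return_length_le:
  assumes "linearly_recurrent K x" "n \<ge> 1" "a < b"
    and eq: "word_at x a n = word_at x b n"
    and between: "\<And>i. a < i \<Longrightarrow> i < b \<Longrightarrow> word_at x i n \<noteq> word_at x b n"
  shows "b - a \<le> K * n"
proof -
  define u w where "u = word_at x b n" and "w = word_at x a (b - a)"
  have wu: "w @ u = word_at x a (b - a + n)"
    using word_at_add[of x a "b - a" n]
    unfolding u_def w_def le_add_diff_inverse[OF less_imp_le[OF \<open>a < b\<close>]]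
    by (rule sym)
  have "i \<in> occs u (w @ u) \<longleftrightarrow> i \<le> b - a \<and> word_at x (a + i) n = u" for i
    unfolding wu occs_iff
    by (auto simp: u_def list_eq_iff_nth_eq add.assoc)
  moreover have "i = 0 \<or> i = b - a" if "i \<le> b - a" "word_at x (a + i) n = u" for i
    using that between[of "a + i"] by (force simp: u_def)
  ultimately have "occs u (w @ u) = {0, b - a}"
    using \<open>a < b\<close> eq by (auto simp: u_def)
  moreover have "w @ u \<in> Fact x" using assms(2) unfolding wu by simp
  moreover have "length w > 0" using assms(3) by (simp add: w_def)
  ultimately have "w \<in> returns x u"
    using assms(3) unfolding returns_def by simp
  moreover have "u \<in> Fact x" using assms(2) by (simp add: u_def)
  ultimately have "length w \<le> K * length u"
    using assms(1) by (auto simp: linearly_recurrent_def)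
  then show ?thesis by (simp add: u_def w_def)
qed

lemma occurrence_in_window:
  assumes LR: "linearly_recurrent K x" and rec: "recurrent x" and n: "n \<ge> 1"
  obtains b where "i \<le> b" "b < i + K * n" "word_at x b n = word_at x m n"
proof -
  have inf: "infinite {j. word_at x j k = word_at x i' k}" if "k \<ge> 1" for i' k
    using rec that word_at_in_Fact[OF that, of x i']
    unfolding recurrent_def by (force simp: word_at_def)
  define S where "S = {j. word_at x j n = word_at x m n}"
  define b where "b = (LEAST j. j \<in> S \<and> i \<le> j)"
  have "infinite S" using inf n by (simp add: S_def)
  then have "\<exists>j. j \<in> S \<and> i \<le> j"
    by (auto simp: infinite_nat_iff_unbounded_le)
  then have b: "b \<in> S" "i \<le> b" and bmin: "\<And>j. j \<in> S \<Longrightarrow> i \<le> j \<Longrightarrow> b \<le> j"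
    using LeastI_ex[of "\<lambda>j. j \<in> S \<and> i \<le> j"] unfolding b_def by (auto intro: Least_le)
  \<comment> \<open>A later copy of the prefix ending with this occurrence has an occurrence before position
    \<open>i\<close>, so the gap bound applies there.\<close>
  obtain r where r: "r > b" "word_at x r (b + n) = word_at x 0 (b + n)"
    using inf[of "b + n" 0] n by (auto simp: infinite_nat_iff_unbounded)
  have shift: "x !! (r + e) = x !! e" if "e < b + n" for e
    using r(2) that by (auto simp: word_at_eq_iff)
  have shiftS: "r + e \<in> S \<longleftrightarrow> e \<in> S" if "e \<le> b" for e
  proof -
    have "word_at x (r + e) n = word_at x e n"
      using shift that by (simp add: word_at_eq_iff add.assoc)
    then show ?thesis by (simp add: S_def)
  qed
  define a where "a = Max {j \<in> S. j < r + i}"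
  have fin: "finite {j \<in> S. j < r + i}" by simp
  have "b \<in> {j \<in> S. j < r + i}" using b r by simp
  then have a: "a \<in> S" "a < r + i" and amax: "\<And>j. j \<in> S \<Longrightarrow> j < r + i \<Longrightarrow> j \<le> a"
    using Max_in[OF fin] Max_ge[OF fin] unfolding a_def by blast+
  \<comment> \<open>By minimality of \<open>b\<close>, shifted by \<open>r\<close>, nothing occurs
    from \<open>r + i\<close> up to \<open>r + b\<close>, and \<open>a\<close> is the last
    occurrence below \<open>r + i\<close>; so \<open>a\<close> and \<open>r + b\<close> are
    neighbours.\<close>
  have "r + b - a \<le> K * n"
  proof (rule return_length_le[OF LR n])
    show "a < r + b" using a b by simp
    show "word_at x a n = word_at x (r + b) n" using a b shiftS[of b] by (simp add: S_def)
    fix j assume j: "a < j" "j < r + b"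
    show "word_at x j n \<noteq> word_at x (r + b) n"
    proof
      assume "word_at x j n = word_at x (r + b) n"
      then have "j \<in> S" using b shiftS[of b] by (simp add: S_def)
      then have "r + i \<le> j" using amax[of j] j by force
      then have "j - r \<in> S" "i \<le> j - r" using \<open>j \<in> S\<close> shiftS[of "j - r"] j by auto
      then show False using bmin[of "j - r"] j \<open>r + i \<le> j\<close> by simp
    qed
  qed
  then have "b < i + K * n" using a by simp
  then show ?thesis using that b by (simp add: S_def)
qed

text \<open>Inside a long enough run of period \<open>d\<close> all words of length \<open>d\<close> are conjugate, hence equal as
  multisets; since every word of length \<open>d\<close> occurs there, comparing neighbouring windows of
  \<open>x\<close> shows that \<open>x\<close> itself has period \<open>d\<close>.\<close>

lemma occurrence_gap:
  assumes LR: "linearly_recurrent K x" and rec: "recurrent x" and "aperiodic x"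
    and d: "d \<ge> 1" and eq: "word_at x i n = word_at x (i + d) n"
  shows "n < K * d"
proof (rule ccontr)
  assume n: "\<not> n < K * d"
  have step: "mset (word_at x (Suc m) d) + {#x !! m#} = mset (word_at x m d) + {#x !! (m + d)#}" for m
  proof -
    have "[x !! m] @ word_at x (Suc m) d = word_at x m (Suc d)"
      using word_at_add[of x m 1 d] by (simp add: word_at_def)
    also have "\<dots> = word_at x m d @ [x !! (m + d)]"
      using word_at_add[of x m d 1] by (simp add: word_at_def)
    finally have "mset ([x !! m] @ word_at x (Suc m) d) = mset (word_at x m d @ [x !! (m + d)])"
      by (rule arg_cong)
    then show ?thesis by simp
  qed
  \<comment> \<open>Sliding the window by one swaps a letter for the equal letter \<open>d\<close>
    places on. The range of \<open>e\<close> covers the \<open>K * d\<close> starting positions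
    among which \<open>occurrence_in_window\<close> finds every factor of length
    \<open>d\<close>.\<close>
  have run: "mset (word_at x (i + e) d) = mset (word_at x i d)" if "e < K * d" for e
    using that
  proof (induction e)
    case (Suc e)
    have "x !! (i + e) = x !! (i + e + d)"
      using eq Suc.prems n by (simp add: word_at_eq_iff algebra_simps)
    then show ?case using step[of "i + e"] Suc by simp
  qed simp
  have all: "mset (word_at x m d) = mset (word_at x i d)" for m
  proof -
    obtain b where "i \<le> b" "b < i + K * d" "word_at x b d = word_at x m d"
      using occurrence_in_window[OF LR rec d] by blast
    then show ?thesis using run[of "b - i"] by simp
  qed
  have "x !! m = x !! (m + d)" for m
    using step[of m] by (simp add: all[of m] all[of "Suc m"])
  then have "x = sdrop d x"
    by (intro stream_eqI) (simp add: sdrop_snth add.commute)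
  then show False using \<open>aperiodic x\<close> d unfolding periodic_def by blast
qed

text \<open>For \<open>K\<close> at most 1, the window from position 1 on would force the first
  letter to reappear at 1, which the gap bound with \<open>d = 1\<close> forbids.\<close>

lemma two_le_constant:
  assumes "linearly_recurrent K x" "recurrent x" "aperiodic x"
  shows "K \<ge> 2"
proof (rule ccontr)
  assume "\<not> 2 \<le> K"
  obtain b where "1 \<le> b" "b < 1 + K * 1" "word_at x b 1 = word_at x 0 1"
    using occurrence_in_window[OF assms(1,2), of 1 1 0] by auto
  moreover from this \<open>\<not> 2 \<le> K\<close> have "b = 1" by linarith
  ultimately show False
    using occurrence_gap[OF assms, of b 0 1] \<open>\<not> 2 \<le> K\<close> by auto
qed

section \<open>Colour sets and infinite factorizations\<close>

text \<open>Lets a colouring take values in any type. The map to the naturals is injective on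
  \<open>D\<close> only, which suffices because the words of a factorization lie in
  \<open>Fact x\<close>.\<close>

lemma Pm_finite_colours:
  fixes c :: "'a list \<Rightarrow> 'c"
  assumes "x \<in> streams A" "finite D" "card D \<le> k" and cD: "\<And>u. u \<in> Fact x \<Longrightarrow> c u \<in> D"
    and av: "avoids c h x"
  shows "x \<in> Pm A h k"
proof -
  obtain f :: "'c \<Rightarrow> nat" where f: "inj_on f D"
    using finite_imp_inj_to_nat_seg[OF \<open>finite D\<close>] by blast
  have c: "c u = c v" if "f (c u) = f (c v)" "u \<in> Fact x" "v \<in> Fact x" for u v
    using that f cD by (auto dest: inj_onD)
  have "avoids (f \<circ> c) h x"
  proof (cases h)
    case (enat n)
    have "list_monochromatic c U"
      if U: "list_factorization U (stake m x)" and "list_monochromatic (f \<circ> c) U" for m U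
    proof -
      have "U ! i \<in> Fact x" if "i < length U" for i
        using U that list_Fact_stake_subset unfolding list_factorization_def by force
      then show ?thesis using that(2) unfolding list_monochromatic_def o_def by (auto intro!: c)
    qed
    then show ?thesis using av enat unfolding avoids_def by auto
  next
    case infinity
    have "monochromatic_stream c U"
      if U: "factorization U x" and "monochromatic_stream (f \<circ> c) U" for U
    proof -
      have "U !! i \<in> Fact x" for i
        using U unfolding factorization_def by (auto simp: sset_range)
      then show ?thesis using that(2) unfolding monochromatic_stream_def o_def by (auto intro!: c)
    qed
    then show ?thesis using av infinity unfolding avoids_def by auto
  qed
  moreover have "card (f ` D) \<le> k"
    using card_image_le[OF \<open>finite D\<close>, of f] assms(3) by linarith
  moreover have "f \<circ> c \<in> Fact x \<rightarrow> f ` D" using cD by auto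
  ultimately show ?thesis using assms(1,2) unfolding Pm_def by blast
qed

lemma flat_shift_concat:
  assumes "\<And>u. u \<in> sset U \<Longrightarrow> u \<noteq> []"
  shows "flat U = concat (stake n U) @- flat (sdrop n U)"
  using assms
proof (induction n arbitrary: U)
  case (Suc n)
  have "flat U = shd U @- flat (stl U)"
    using Suc.prems by (intro flat_unfold) (simp add: shd_sset)
  also have "flat (stl U) = concat (stake n (stl U)) @- flat (sdrop n (stl U))"
    using Suc.prems by (intro Suc.IH) (simp add: stl_sset)
  finally show ?case by simp
qed simp

lemma avoids_infinity:
  assumes av: "avoids c (enat n) x"
  shows "avoids c \<infinity> x"
proof -
  have False if U: "factorization U x" "monotone_stream U" "monochromatic_stream c U" for U
  proof -
    let ?V = "stake n U"
    have nonempty: "u \<noteq> []" if "u \<in> sset U" for u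
      using that U(1) Fact_nonempty unfolding factorization_def by blast
    have "x = concat ?V @- flat (sdrop n U)"
      using flat_shift_concat[OF nonempty] U(1) by (simp add: factorization_def)
    moreover have "stake (length (concat ?V)) (concat ?V @- flat (sdrop n U)) = concat ?V"
      by (simp add: stake_shift)
    ultimately have "concat ?V = stake (length (concat ?V)) x" by metis
    moreover have "set ?V \<subseteq> list_Fact (concat ?V)"
    proof
      fix u assume u: "u \<in> set ?V"
      then obtain i where "u = U !! i" by (auto simp: in_set_conv_nth)
      then have "u \<noteq> []" using nonempty by simp
      moreover obtain a b where "?V = a @ u # b" using u by (meson split_list)
      ultimately show "u \<in> list_Fact (concat ?V)"
        by (auto simp: list_Fact_def sublist_def)
    qed
    ultimately have "list_factorization ?V (stake (length (concat ?V)) x)"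
      by (simp add: list_factorization_def)
    moreover have "list_monotone ?V" "list_monochromatic c ?V"
      using U(2,3) by (auto simp: list_monotone_def monotone_stream_def
          list_monochromatic_def monochromatic_stream_def)
    ultimately show False using av unfolding avoids_def by auto
  qed
  then show ?thesis unfolding avoids_def by auto
qed

section \<open>Words that are not recurrent\<close>

lemma flat_sconst_periodic:
  assumes "u \<noteq> []" "x = flat (sconst u)"
  shows "periodic x"
proof -
  have "x = u @- x"
    using assms flat_unfold[of "sconst u"] by (metis siterate.sel id_apply)
  moreover have "sdrop (length u) (u @- x) = x" by (simp add: sdrop_shift)
  ultimately have "x = sdrop (length u) x" by metis
  moreover have "length u \<ge> 1" using assms(1) by (simp add: Suc_leI)
  ultimately show ?thesis unfolding periodic_def by blast
qed

text \<open>If \<open>M\<close> is the last occurrence of a factor \<open>u\<close> that occurs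
  finitely often, the prefix ending with it cannot reappear at \<open>i >= 1\<close>: that would put
  \<open>u\<close> at \<open>i + M\<close>.\<close>

lemma prefix_occurring_once:
  assumes "\<not> recurrent x"
  obtains n where "\<And>i. i \<ge> 1 \<Longrightarrow> word_at x i n \<noteq> word_at x 0 n"
proof -
  obtain u where u: "u \<in> Fact x" "finite {i. word_at x i (length u) = u}"
    using assms by (auto simp: recurrent_def word_at_def)
  define S where "S = {i. word_at x i (length u) = u}"
  obtain j where "u = word_at x j (length u)" using Fact_word_at[OF u(1)] by blast
  then have "j \<in> S" unfolding S_def by (intro CollectI) (rule sym)
  then have "S \<noteq> {}" by blast
  define M where "M = Max S"
  have M: "M \<in> S" "\<And>i. i \<in> S \<Longrightarrow> i \<le> M"
    using u(2) \<open>S \<noteq> {}\<close> unfolding M_def S_def[symmetric] by auto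
  show ?thesis
  proof (rule that, rule notI)
    fix i assume i: "i \<ge> 1" "word_at x i (M + length u) = word_at x 0 (M + length u)"
    then have "word_at x (i + M) (length u) = word_at x M (length u)"
      by (simp add: word_at_eq_iff add.assoc)
    then have "i + M \<in> S" using M by (simp add: S_def)
    then show False using M(2) i(1) by force
  qed
qed

text \<open>If the first word is short, all words equal it and \<open>x\<close> is periodic.
  Otherwise it starts with \<open>p\<close>; by monotonicity the second word is long too, so by its
  colour it starts with \<open>p\<close>, a second occurrence.\<close>

lemma Pm_class_of_nonrecurrent:
  assumes A: "finite A" "x \<in> streams A" and "aperiodic x" and nrec: "\<not> recurrent x"
  shows "x \<in> Pm_class A"
proof -
  obtain n where once: "\<And>i. i \<ge> 1 \<Longrightarrow> word_at x i n \<noteq> word_at x 0 n"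
    using prefix_occurring_once[OF nrec] by blast
  define p where "p = word_at x 0 n"
  \<comment> \<open>Factors are nonempty, so the component \<open>[]\<close> tells long words from
    short ones.\<close>
  define c where "c u = (if length u < n then (u, False) else ([], take n u = p))" for u
  define D where "D = {u. set u \<subseteq> A \<and> length u \<le> n} \<times> (UNIV :: bool set)"
  have fin: "finite D"
    using finite_lists_length_le[OF A(1)] by (simp add: D_def)
  have "c u \<in> D" if "u \<in> Fact x" for u
  proof -
    obtain i where "u = word_at x i (length u)" using Fact_word_at \<open>u \<in> Fact x\<close> by blast
    then have "set u \<subseteq> A"
      using A(2) nth_word_at[of _ "length u" x i]
      by (metis in_set_conv_nth streams_iff_snth subsetI)
    then show ?thesis by (auto simp: c_def D_def)
  qed
  moreover have "avoids c \<infinity> x"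
  proof -
    have False if U: "factorization U x" "monotone_stream U" "monochromatic_stream c U" for U
    proof -
      have nonempty: "u \<noteq> []" if "u \<in> sset U" for u
        using that U(1) Fact_nonempty unfolding factorization_def by blast
      have x: "x = flat U" using U(1) by (simp add: factorization_def)
      have x01: "x = U !! 0 @- U !! 1 @- flat (sdrop 2 U)"
        using flat_shift_concat[OF nonempty, where n = 2] x by (simp add: numeral_2_eq_2)
      have same: "c (U !! i) = c (U !! 0)" for i
        using U(3) unfolding monochromatic_stream_def by blast
      show False
      proof (cases "length (U !! 0) < n")
        case True
        then have "U !! i = U !! 0" for i
          using same[of i] True nonempty[of "U !! 0"]
          by (auto simp: c_def simp del: snth.simps split: if_splits)
        then have "U = sconst (U !! 0)" by (intro stream_eqI) simp
        then have "periodic x"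
          using flat_sconst_periodic[of "U !! 0" x] x nonempty[of "U !! 0"] by (metis snth_sset)
        then show False using \<open>aperiodic x\<close> by blast
      next
        case False
        moreover have "length (U !! 0) \<le> length (U !! 1)"
          using U(2) unfolding monotone_stream_def by (metis zero_le)
        moreover have "take n (U !! 0) = p"
          using False unfolding p_def
          by (subst x01) (simp add: word_at_def stake_shift del: snth.simps)
        ultimately have "take n (U !! 1) = p"
          using same[of 1] by (simp add: c_def del: snth.simps split: if_splits)
        moreover have "take n (U !! 1) = word_at x (length (U !! 0)) n"
          using False \<open>length (U !! 0) \<le> length (U !! 1)\<close>
          by (subst x01) (simp add: word_at_def stake_shift sdrop_shift del: snth.simps)
        moreover have "length (U !! 0) \<ge> 1"
          using nonempty[of "U !! 0"] by (metis One_nat_def Suc_leI length_greater_0_conv snth_sset)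
        ultimately show False using once unfolding p_def by metis
      qed
    qed
    then show ?thesis unfolding avoids_def by auto
  qed
  ultimately have "x \<in> Pm A \<infinity> (max 1 (card D))"
    using A(2) fin by (intro Pm_finite_colours[where c = c and D = D]) auto
  then show ?thesis unfolding Pm_class_def by (metis UN_I atLeast_iff max.cobounded1)
qed

section \<open>Locating words by buckets of positions\<close>

lemma div_eq_imp_diff_less:
  fixes a b n :: nat
  assumes "a div n = b div n" "n > 0" "a \<le> b"
  shows "b - a < n"
proof -
  have "b div n * n \<le> a" by (metis assms(1) div_times_less_eq_dividend)
  moreover have "b < n + b div n * n"
    using dividend_less_div_times[OF \<open>n > 0\<close>, of b] by simp
  ultimately show ?thesis using assms(3) by linarith
qed

text \<open>Positions carrying the same word of length \<open>n\<close> are more than \<open>n / K\<close> apart.\<close>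

lemma occurrence_bucket_inj:
  assumes "linearly_recurrent K x" "recurrent x" "aperiodic x" and n: "n > 0"
    and eq: "word_at x (a + i) n = word_at x (a + j) n" and bucket: "K * i div n = K * j div n"
  shows "i = j"
proof -
  have False
    if "i < j" "word_at x (a + i) n = word_at x (a + j) n" "K * i div n = K * j div n" for i j
  proof -
    have "n < K * (j - i)"
      using occurrence_gap[OF assms(1-3), of "j - i" "a + i" n] that by simp
    moreover have "K * j - K * i < n"
      using that n by (intro div_eq_imp_diff_less) auto
    ultimately show False by (simp add: diff_mult_distrib2)
  qed
  from this[of i j] this[of j i] eq bucket show ?thesis by (metis linorder_neqE_nat)
qed

text \<open>The positions \<open>i\<close>, \<open>j\<close>, \<open>i + length u\<close> and
  \<open>j + length v\<close> are occurrences of \<open>p\<close>. Equal buckets give first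
  \<open>i = j\<close>, then equal lengths; start and length determine the word.\<close>

lemma word_determined_by_buckets:
  assumes LR: "linearly_recurrent K x" "recurrent x" "aperiodic x" and n: "n > 0"
    and u: "word_at x i (length u + n) = u @ p" "take n u = p" "n \<le> length u"
    and v: "word_at x j (length v + n) = v @ p" "take n v = p" "n \<le> length v"
    and buckets: "K * i div n = K * j div n" "K * length u div n = K * length v div n"
  shows "u = v"
proof -
  have occ: "word_at x i (length w) = w \<and> word_at x (i + length w) n = p \<and> word_at x i n = p"
    if "word_at x i (length w + n) = w @ p" "take n w = p" "n \<le> length w" for w i
  proof -
    have "word_at x i (length w) = w" "word_at x (i + length w) n = p"
      using that(1) by (simp_all add: word_at_add)
    moreover have "word_at x i n = take n (word_at x i (length w))" using that(3) by simp
    ultimately show ?thesis using that(2) by simp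
  qed
  have "i = j"
    using occurrence_bucket_inj[OF LR n, of 0 i j] occ[OF u] occ[OF v] buckets by simp
  moreover have "length u = length v"
    using occurrence_bucket_inj[OF LR n, of i "length u" "length v"] occ[OF u] occ[OF v]
      buckets \<open>i = j\<close> by simp
  ultimately show ?thesis using occ[OF u] occ[OF v] by metis
qed

section \<open>The colouring of a recurrent word\<close>

text \<open>The bound counts two exceptional colours, then three residues of the level,
  \<open>K ^ 2 * (K + 1)\<close> buckets for the position and \<open>K ^ 2\<close> for the
  length.\<close>

lemma Pm_of_recurrent:
  assumes "x \<in> streams A" and LR: "linearly_recurrent K x" "recurrent x" "aperiodic x"
    and k: "2 + 3 * (K ^ 2 * (K + 1)) * K ^ 2 \<le> k"
  shows "x \<in> Pm A (enat (K + 1)) k"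
proof -
  have K: "K \<ge> 2" using two_le_constant[OF LR] .
  have "\<exists>j. K ^ j \<le> length u \<and> length u < K ^ (j + 1)" if "u \<noteq> []" for u :: "'a list"
    using that K by (intro ex_power_ivl1) (auto simp: Suc_leI)
  then obtain lev :: "'a list \<Rightarrow> nat"
    where lev: "\<And>u. u \<noteq> [] \<Longrightarrow> K ^ lev u \<le> length u \<and> length u < K ^ (lev u + 1)"
    by metis
  define n where "n u = K ^ lev u" for u
  define p where "p u = word_at x 0 (n u)" for u
  \<comment> \<open>\<open>LEAST\<close> has a witness only if \<open>u @ p u\<close> is a factor;
    \<open>c\<close> consults \<open>pos\<close> only in that case.\<close>
  define pos where "pos u = (LEAST i. word_at x i (length u + n u) = u @ p u)" for u
  \<comment> \<open>The tags 3 and 4 cannot collide with a residue modulo 3.\<close>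
  define c where "c u =
    (if take (n u) u \<noteq> p u then (3, 0, 0) else if u @ p u \<notin> Fact x then (4, 0, 0)
     else (lev u mod 3, K * pos u div n u, K * length u div n u))" for u
  define D where
    "D = insert (3, 0, 0) (insert (4, 0, 0) ({..<3::nat} \<times> {..<K ^ 2 * (K + 1)} \<times> {..<K ^ 2}))"
  have n_pos: "n u > 0" for u using K by (simp add: n_def)
  have n_le: "n u \<le> length u" and less_n: "length u < K * n u" if "u \<noteq> []" for u
    using lev[OF that] by (auto simp: n_def)
  have pos: "word_at x (pos u) (length u + n u) = u @ p u"
    and pos_less: "pos u < K * (length u + n u)" if u: "u @ p u \<in> Fact x" for u
  proof -
    have len: "length (u @ p u) = length u + n u" by (simp add: p_def)
    then obtain m where m: "word_at x m (length u + n u) = u @ p u"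
      using Fact_word_at[OF u] by metis
    obtain b where "b < 0 + K * (length u + n u)"
      "word_at x b (length u + n u) = word_at x m (length u + n u)"
      using occurrence_in_window[OF LR(1,2), of "length u + n u" 0 m] n_pos[of u] by auto
    then have b: "word_at x b (length u + n u) = u @ p u" "b < K * (length u + n u)"
      using m by auto
    show "word_at x (pos u) (length u + n u) = u @ p u"
      unfolding pos_def using b(1) by (rule LeastI)
    have "pos u \<le> b" unfolding pos_def using b(1) by (rule Least_le)
    then show "pos u < K * (length u + n u)" using b(2) by simp
  qed
  have cD: "c u \<in> D" if "u \<in> Fact x" for u
  proof -
    have "u \<noteq> []" using that by (rule Fact_nonempty)
    have "K * length u div n u < K ^ 2"
      using less_n[OF \<open>u \<noteq> []\<close>] n_pos[of u] K
      by (simp add: div_less_iff_less_mult power2_eq_square mult.assoc)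
    moreover have "K * pos u div n u < K ^ 2 * (K + 1)" if "u @ p u \<in> Fact x"
    proof -
      \<comment> \<open>The window of \<open>u @ p u\<close> at position 0 bounds its first
        occurrence.\<close>
      have "pos u < K * (length u + n u)" using pos_less that .
      also have "\<dots> \<le> K * (K * n u + n u)" using less_n[OF \<open>u \<noteq> []\<close>] by simp
      finally have "K * pos u < K * (K * (K * n u + n u))" using K by simp
      also have "\<dots> = K ^ 2 * (K + 1) * n u" by (simp add: power2_eq_square algebra_simps)
      finally show ?thesis using n_pos[of u] by (simp add: div_less_iff_less_mult)
    qed
    ultimately show ?thesis by (auto simp: c_def D_def)
  qed
  have c_inj: "u = v"
    if "lev u = lev v" "c u = c v" "take (n u) u = p u" "take (n v) v = p v"
      "u \<noteq> []" "v \<noteq> []" "u @ p u \<in> Fact x" "v @ p v \<in> Fact x" for u v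
  proof -
    have nv: "n v = n u" "p v = p u" using that(1) by (simp_all add: n_def p_def)
    have eq: "K * pos u div n u = K * pos v div n u" "K * length u div n u = K * length v div n u"
      using that by (auto simp: c_def nv)
    show ?thesis
      using word_determined_by_buckets[OF LR n_pos[of u] pos[OF that(7)] that(3) n_le[OF that(5)]
          pos[OF that(8), unfolded nv] that(4)[unfolded nv] n_le[OF that(6), unfolded nv] eq] .
  qed
  have "avoids c (enat (K + 1)) x"
  proof -
    have False
      if U: "list_factorization U (stake m x)" "length U = K + 1" "list_monotone U"
        "list_monochromatic c U" for m U
    proof -
      define s where "s i = length (concat (take i U))" for i
      have nonempty: "U ! i \<noteq> []" if "i \<le> K" for i
      proof -
        have "U ! i \<in> set U" using that U(2) by simp
        then show ?thesis using U(1) by (auto simp: list_factorization_def list_Fact_def)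
      qed
      have same: "c (U ! i) = c (U ! 0)" if "i \<le> K" for i
        using U(2,4) that unfolding list_monochromatic_def by auto
      have mono: "length (U ! 0) \<le> length (U ! i)" if "i \<le> K" for i
        using U(2,3) that unfolding list_monotone_def by auto
      have s_Suc: "s (Suc i) = s i + length (U ! i)" if "i \<le> K" for i
        using that U(2) by (simp add: s_def take_Suc_conv_app_nth)
      have s0: "s 0 = 0" by (simp add: s_def)
      have at: "word_at x (s i) (length (U ! i)) = U ! i" if i: "i \<le> K" for i
      proof -
        have "stake m x = concat (take i U @ U ! i # drop (Suc i) U)"
          using U(1,2) i by (subst id_take_nth_drop[symmetric]) (auto simp: list_factorization_def)
        then have eq: "stake m x = concat (take i U) @ U ! i @ concat (drop (Suc i) U)" by simp
        have x: "x = concat (take i U) @- U ! i @- concat (drop (Suc i) U) @- sdrop m x"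
          using stake_sdrop[of m x] unfolding eq by simp
        show ?thesis
          by (subst x) (simp add: word_at_def s_def sdrop_shift stake_shift)
      qed
      \<comment> \<open>\<open>U ! 0\<close> is a prefix of \<open>x\<close> of length at least
        \<open>n (U ! 0)\<close>, so its tag is not 3, and hence no word of the factorization has
        tag 3.\<close>
      have take0: "take (n (U ! 0)) (U ! 0) = p (U ! 0)"
        using arg_cong[OF at[of 0], of "take (n (U ! 0))"] n_le[OF nonempty[of 0]]
        by (simp add: s0 p_def)
      have take_p: "take (n (U ! i)) (U ! i) = p (U ! i)" if "i \<le> K" for i
        using same[OF that] take0 by (auto simp: c_def split: if_splits)
      have at_p: "word_at x (s i) (n (U ! i)) = p (U ! i)" if "i \<le> K" for i
        using arg_cong[OF at[OF that], of "take (n (U ! i))"] n_le[OF nonempty[OF that]]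
          take_p[OF that] by simp
      have lev_mono: "lev (U ! 0) \<le> lev (U ! i)" if "i \<le> K" for i
      proof -
        have "K ^ lev (U ! 0) < K ^ (lev (U ! i) + 1)"
          using lev[OF nonempty[of 0]] lev[OF nonempty[OF that]] mono[OF that] by linarith
        then show ?thesis using K by (simp add: power_strict_increasing_iff del: power_Suc)
      qed
      \<comment> \<open>\<open>U ! 1\<close> starts with a prefix of \<open>x\<close> of at least
        the same level, hence with \<open>p (U ! 0)\<close>; this excludes tag 4.\<close>
      have "U ! 0 @ p (U ! 0) \<in> Fact x"
      proof -
        have le: "n (U ! 0) \<le> n (U ! 1)"
          using lev_mono[of 1] K unfolding n_def by (intro power_increasing) auto
        have "word_at x (s 1) (n (U ! 0)) = p (U ! 0)"
          using arg_cong[OF at_p[of 1], of "take (n (U ! 0))"] K le by (simp add: p_def)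
        then have "U ! 0 @ p (U ! 0) = word_at x 0 (length (U ! 0) + n (U ! 0))"
          using at[of 0] s_Suc[of 0] by (simp add: word_at_add s0)
        then show ?thesis using n_pos[of "U ! 0"] by simp
      qed
      then have c0: "c (U ! 0) = (lev (U ! 0) mod 3,
          K * pos (U ! 0) div n (U ! 0), K * length (U ! 0) div n (U ! 0))"
        using take0 by (simp add: c_def)
      have mod3: "(3::nat) \<noteq> l mod 3" "(4::nat) \<noteq> l mod 3" for l
        using mod_less_divisor[of 3 l] by linarith+
      have Fact_i: "U ! i @ p (U ! i) \<in> Fact x" and lev_mod: "lev (U ! i) mod 3 = lev (U ! 0) mod 3"
        if "i \<le> K" for i
        using same[OF that] take_p[OF that] mod3 unfolding c0
        by (auto simp: c_def split: if_splits)
      \<comment> \<open>The words before \<open>U ! i\<close> are shorter than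
        \<open>K * n (U ! 0)\<close>, so \<open>s i\<close> is at most
        \<open>K ^ 2 * n (U ! 0)\<close>. As \<open>p (U ! i)\<close> occurs at 0 and at
        \<open>s i\<close>, the gap bound makes \<open>n (U ! i)\<close> less than
        \<open>K ^ 3 * n (U ! 0)\<close>: fewer than three levels up, and the residue modulo 3
        decides.\<close>
      have lev_eq: "lev (U ! i) = lev (U ! 0)" if "i \<le> K" for i
        using that
      proof (induction i rule: less_induct)
        case (less i)
        show ?case
        proof (cases "i = 0")
          case False
          let ?N = "K * n (U ! 0)"
          have "s k \<le> k * ?N" if "k \<le> i" for k
            using that
          proof (induction k)
            case (Suc k)
            have "length (U ! k) < ?N"
              using less_n[OF nonempty[of k]] less.IH[of k] less.prems Suc.prems by (simp add: n_def)
            then show ?case using Suc s_Suc[of k] less.prems by simp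
          qed (simp add: s0)
          then have "s i \<le> i * ?N" by simp
          also have "\<dots> \<le> K * ?N" using less.prems by simp
          finally have "s i \<le> K * ?N" .
          moreover have "s i \<ge> 1"
          proof -
            have "s i = s (i - 1) + length (U ! (i - 1))"
              using s_Suc[of "i - 1"] False less.prems by simp
            moreover have "length (U ! (i - 1)) \<ge> 1"
              using nonempty[of "i - 1"] less.prems by (simp add: Suc_leI)
            ultimately show ?thesis by linarith
          qed
          then have "n (U ! i) < K * s i"
            using occurrence_gap[OF LR, of "s i" 0 "n (U ! i)"] at_p[OF less.prems]
            by (simp add: p_def)
          ultimately have "n (U ! i) < K * (K * ?N)"
            by (meson less_le_trans mult_le_mono2)
          then have "K ^ lev (U ! i) < K ^ (lev (U ! 0) + 3)"
            by (simp add: n_def power_add numeral_3_eq_3 algebra_simps)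
          then have "lev (U ! i) < lev (U ! 0) + 3"
            using K by (simp add: power_strict_increasing_iff)
          moreover have "3 dvd lev (U ! i) - lev (U ! 0)"
            using lev_mod[OF less.prems] lev_mono[OF less.prems] by (simp add: mod_eq_dvd_iff_nat)
          ultimately have "lev (U ! i) - lev (U ! 0) = 0"
            using dvd_imp_le[of 3 "lev (U ! i) - lev (U ! 0)"] by linarith
          then show ?thesis using lev_mono[OF less.prems] by simp
        qed simp
      qed
      define w where "w = U ! 0"
      have U_w: "U ! i = w" if "i \<le> K" for i
        unfolding w_def
        by (rule c_inj[OF lev_eq[OF that] same[OF that] take_p[OF that] take0
              nonempty[OF that] nonempty[OF le0] Fact_i[OF that] Fact_i[OF le0]])
      have s_w: "s i = i * length w" if "i \<le> K" for i
        using that by (induction i) (simp_all add: s0 s_Suc U_w)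
      have w: "length w > 0" using nonempty[of 0] by (simp add: w_def)
      have x_w: "x !! (i * length w + f) = w ! f" if "i \<le> K" "f < length w" for i f
        using arg_cong[OF at[OF that(1)], of "\<lambda>v. v ! f"] that by (simp add: U_w s_w)
      \<comment> \<open>The \<open>K + 1\<close> equal words give period \<open>length w\<close>
        over a stretch of \<open>K * length w\<close>, the least length that
        \<open>occurrence_gap\<close> excludes.\<close>
      have "x !! e = x !! (length w + e)" if "e < K * length w" for e
      proof -
        let ?i = "e div length w" and ?f = "e mod length w"
        have "?i < K" using that w by (simp add: div_less_iff_less_mult)
        moreover have "?f < length w" using w by simp
        ultimately have "x !! (?i * length w + ?f) = x !! (Suc ?i * length w + ?f)"
          using x_w[of ?i ?f] x_w[of "Suc ?i" ?f] by (simp del: div_mult_mod_eq)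
        then show ?thesis by (simp add: add.assoc)
      qed
      then have "word_at x 0 (K * length w) = word_at x (0 + length w) (K * length w)"
        by (simp add: word_at_eq_iff)
      then show False
        using occurrence_gap[OF LR, of "length w" 0 "K * length w"] w by simp
    qed
    then show ?thesis unfolding avoids_def by auto
  qed
  moreover have "finite D" by (simp add: D_def)
  moreover have "card D \<le> k"
  proof -
    have "card D \<le> 2 + card ({..<3::nat} \<times> {..<K ^ 2 * (K + 1)} \<times> {..<K ^ 2})"
      unfolding D_def by (simp add: card_insert_if)
    also have "\<dots> \<le> k" using k by (simp add: card_cartesian_product algebra_simps)
    finally show ?thesis .
  qed
  ultimately show ?thesis
    using assms(1) cD by (intro Pm_finite_colours[where c = c and D = D]) auto
qed

section \<open>Counting colours and conclusion\<close>

text \<open>The summand with \<open>i = 4\<close> alone is large enough; it is present because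
  \<open>K >= 2\<close> makes \<open>K ^ 5 - 1\<close> at least 4.\<close>

lemma colour_count_le:
  assumes "(K::nat) \<ge> 2"
  shows "3 * (K ^ 2 * (K + 1)) * K ^ 2 \<le> (\<Sum>i = 0..K ^ 5 - 1. 2 * K ^ i * (K + 1) ^ (2 * i))"
proof -
  have "4 * 1 \<le> K ^ 5 - (1::nat)"
    using power_mono[OF assms, of 5] by simp
  then have "2 * K ^ 4 * (K + 1) ^ (2 * 4) \<le> (\<Sum>i = 0..K ^ 5 - 1. 2 * K ^ i * (K + 1) ^ (2 * i))"
    by (intro member_le_sum) auto
  moreover have "3 * (K ^ 2 * (K + 1)) * K ^ 2 \<le> 2 * K ^ 4 * (K + 1) ^ (2 * 4)"
  proof -
    have "3 * (K + 1) \<le> 2 * (K + 1) ^ 2" using assms by (simp add: power2_eq_square)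
    also have "\<dots> \<le> 2 * (K + 1) ^ 8" by (intro mult_le_mono2 power_increasing) auto
    finally have "K ^ 4 * (3 * (K + 1)) \<le> K ^ 4 * (2 * (K + 1) ^ 8)" by (rule mult_le_mono2)
    then show ?thesis by (simp add: algebra_simps flip: power_add)
  qed
  ultimately show ?thesis by linarith
qed

theorem theorem6:
  fixes A :: "'a set" and K :: nat and x :: "'a stream"
  assumes "finite A" and "K \<ge> 1" and "x \<in> streams A"
    and "linearly_recurrent K x" and "aperiodic x"
  shows "x \<in> Pm_class A \<and>
    (recurrent x \<longrightarrow>
      x \<in> Pm A (enat (K + 1)) (2 + (\<Sum>i = 0..K ^ 5 - 1. 2 * K ^ i * (K + 1) ^ (2 * i))))"
proof (cases "recurrent x")
  case True
  let ?k = "2 + (\<Sum>i = 0..K ^ 5 - 1. 2 * K ^ i * (K + 1) ^ (2 * i))"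
  have "K \<ge> 2" using two_le_constant True assms by blast
  then have Pm: "x \<in> Pm A (enat (K + 1)) ?k"
    using True assms colour_count_le[of K] by (intro Pm_of_recurrent) auto
  then have "x \<in> Pm A \<infinity> ?k"
    unfolding Pm_def using avoids_infinity by fast
  then have "x \<in> Pm_class A" unfolding Pm_class_def by (rule UN_I[rotated]) simp
  with Pm show ?thesis by blast
next
  case False
  then show ?thesis using Pm_class_of_nonrecurrent assms by blast
qed

end
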